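(* For a nontrivial atomic Puiseux monoid $M$, the following statements are equivalent. (1) $M$ is a UFM. (2) $M$ is an HFM. (3) $M \cong (\mathbb{N}_0,+)$. (4) $M$ contains a prime element.
   Context: $\mathbb{N}_0 = \{0,1,2,\dots\}$. A Puiseux monoid is an additive submonoid $M$ of $\mathbb{Q}_{\ge 0}$; it is nontrivial if $M \ne \{0\}$. An element $a \in M\setminus\{0\}$ is an atom if $a = x+y$ with $x,y \in M$ implies $x=0$ or $y=0$; $M$ is atomic if each nonzero element is a (finite) sum of atoms. A factorization of $x \in M$ is a finite multiset of atoms of $M$ with sum $x$; its length is the number of atoms counted with multiplicity; $\mathsf{Z}(x)$ is the set of factorizations of $x$, and $\mathsf{L}(x)$ the set of their lengths. An atomic $M$ is a UFM (factorial monoid) if $|\mathsf{Z}(x)| = 1$ for all $x \in M$, and an HFM (half-factorial monoid) if $|\mathsf{L}(x)| = 1$ for all $x \in M$. For $x,y \in M$, $x \mid_M y$ means $y = x + x'$ for some $x' \in M$; an element $p \in M\setminus\{0\}$ is prime if $p \mid_M x+y$ with $x,y\in M$ implies $p \mid_M x$ or $p \mid_M y$. *)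

theory Defs
  imports "HOL-Algebra.Group" "HOL-Library.Multiset" "HOL.Rat"
begin

definition additive_monoid :: "'a::comm_monoid_add set \<Rightarrow> 'a monoid" where
  "additive_monoid A = \<lparr>carrier = A, monoid.mult = (+), one = 0\<rparr>"

definition puiseux_monoid :: "rat set \<Rightarrow> bool" where
  "puiseux_monoid M \<longleftrightarrow> submonoid M (additive_monoid {q::rat. 0 \<le> q})"

definition atoms :: "rat set \<Rightarrow> rat set" where
  "atoms M = {a \<in> M - {0}. \<forall>x\<in>M. \<forall>y\<in>M. a = x + y \<longrightarrow> x = 0 \<or> y = 0}"

definition factorizations :: "rat set \<Rightarrow> rat \<Rightarrow> rat multiset set" where
  "factorizations M x = {F. set_mset F \<subseteq> atoms M \<and> sum_mset F = x}"

definition lengths :: "rat set \<Rightarrow> rat \<Rightarrow> nat set" where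
  "lengths M x = size ` factorizations M x"

definition atomic :: "rat set \<Rightarrow> bool" where
  "atomic M \<longleftrightarrow> (\<forall>x\<in>M - {0}. \<exists>F. set_mset F \<subseteq> atoms M \<and> sum_mset F = x)"

(* For x = 0 the only factorization is the empty multiset. A cardinality of 1
   also excludes infinite sets, whose card is 0. *)
definition UFM :: "rat set \<Rightarrow> bool" where
  "UFM M \<longleftrightarrow> atomic M \<and> (\<forall>x\<in>M. card (factorizations M x) = 1)"

definition HFM :: "rat set \<Rightarrow> bool" where
  "HFM M \<longleftrightarrow> atomic M \<and> (\<forall>x\<in>M. card (lengths M x) = 1)"

definition divides_in :: "rat set \<Rightarrow> rat \<Rightarrow> rat \<Rightarrow> bool" where
  "divides_in M x y \<longleftrightarrow> (\<exists>x'\<in>M. y = x + x')"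

definition prime_in :: "rat set \<Rightarrow> rat \<Rightarrow> bool" where
  "prime_in M p \<longleftrightarrow> p \<in> M - {0} \<and>
     (\<forall>x\<in>M. \<forall>y\<in>M. divides_in M p (x + y) \<longrightarrow> divides_in M p x \<or> divides_in M p y)"

end

theory Submission
  imports Defs
begin

text \<open>
  Any two positive rationals have a common positive multiple. Applied to two atoms, or to a prime
  and an atom, this forces them to coincide: in a half-factorial monoid the two ways of writing the
  multiple must have equal length, and a prime dividing the multiple divides the atom. An isomorphism
  with the naturals maps every atom to 1. So each of the four conditions says that there is exactly
  one atom.
\<close>

lemma puiseux_monoidD:
  assumes "puiseux_monoid M"
  shows "0 \<in> M" and "\<And>x y. x \<in> M \<Longrightarrow> y \<in> M \<Longrightarrow> x + y \<in> M" and "\<And>x. x \<in> M \<Longrightarrow> 0 \<le> x"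
  using assms
  by (auto simp: puiseux_monoid_def additive_monoid_def submonoid_def)

lemma puiseux_monoid_of_nat_mult:
  assumes "puiseux_monoid M" and "x \<in> M"
  shows "of_nat n * x \<in> M"
  by (induction n) (auto simp: distrib_right puiseux_monoidD[OF assms(1)] assms(2))

text \<open>Writing \<open>a / b\<close> as a quotient of positive integers and clearing
  denominators gives the two multipliers.\<close>

lemma common_multiple_pos_rat:
  fixes a b :: rat
  assumes "0 < a" and "0 < b"
  obtains m n :: nat where "0 < m" and "0 < n" and "of_nat m * a = of_nat n * b"
proof -
  have "0 < a / b" using assms by simp
  obtain p q :: int where pq: "a / b = of_int p / of_int q" "0 < q"
    by (metis quotient_of_denom_pos' quotient_of_div surj_pair snd_conv)
  with \<open>0 < a / b\<close> have "0 < p"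
    by (simp add: zero_less_divide_iff)
  have "of_int q * a = of_int p * b"
    using pq assms by (simp add: field_simps)
  with \<open>0 < p\<close> \<open>0 < q\<close> show thesis
    by (intro that[of "nat q" "nat p"]) simp_all
qed

lemma atoms_pos:
  assumes "puiseux_monoid M" and "a \<in> atoms M"
  shows "0 < a"
  using assms(2) puiseux_monoidD(3)[OF assms(1), of a] by (auto simp: atoms_def)

lemma replicate_mset_in_factorizations:
  assumes "a \<in> atoms M"
  shows "replicate_mset n a \<in> factorizations M (of_nat n * a)"
  using assms by (auto simp: factorizations_def set_mset_replicate_mset_subset)

text \<open>\<open>atomic\<close> speaks only of nonzero elements; for 0 the empty multiset
  serves.\<close>

lemma factorizations_nonempty:
  assumes "atomic M" and "x \<in> M"
  shows "factorizations M x \<noteq> {}"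
proof (cases "x = 0")
  case True
  then have "{#} \<in> factorizations M x" by (simp add: factorizations_def)
  then show ?thesis by blast
next
  case False
  with assms show ?thesis by (auto simp: atomic_def factorizations_def)
qed

lemma UFM_imp_HFM:
  assumes "UFM M"
  shows "HFM M"
  using assms by (fastforce simp: UFM_def HFM_def lengths_def card_1_singleton_iff)

lemma atoms_nonempty:
  assumes "puiseux_monoid M" and "M \<noteq> {0}" and "atomic M"
  shows "atoms M \<noteq> {}"
proof -
  obtain x where "x \<in> M" "x \<noteq> 0"
    using assms(2) puiseux_monoidD(1)[OF assms(1)] by blast
  with assms(3) obtain F where "set_mset F \<subseteq> atoms M" "sum_mset F = x"
    by (auto simp: atomic_def)
  with \<open>x \<noteq> 0\<close> show ?thesis by fastforce
qed

text \<open>A common multiple of \<open>a\<close> and \<open>b\<close> is a sum of \<open>m\<close>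
  copies of \<open>a\<close> and of \<open>n\<close> copies of \<open>b\<close>. Equal lengths give
  \<open>m = n\<close>, and this positive factor cancels.\<close>

lemma HFM_atoms_eq:
  assumes "puiseux_monoid M" and "HFM M" and "a \<in> atoms M" and "b \<in> atoms M"
  shows "a = b"
proof -
  have "0 < a" "0 < b" using assms atoms_pos by auto
  then obtain m n :: nat where mn: "0 < m" "0 < n" "of_nat m * a = of_nat n * b"
    by (rule common_multiple_pos_rat)
  let ?x = "of_nat m * a"
  have "?x \<in> M"
    using assms(1,3) by (auto simp: atoms_def intro: puiseux_monoid_of_nat_mult)
  then have "card (lengths M ?x) = 1"
    using assms(2) by (simp add: HFM_def)
  moreover have "m \<in> lengths M ?x"
    using replicate_mset_in_factorizations[OF assms(3), of m]
    unfolding lengths_def by (metis imageI size_replicate_mset)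
  moreover have "n \<in> lengths M ?x"
    using replicate_mset_in_factorizations[OF assms(4), of n] mn(3)
    unfolding lengths_def by (metis imageI size_replicate_mset)
  ultimately have "m = n"
    by (auto simp: card_1_singleton_iff)
  with mn show ?thesis by simp
qed

text \<open>Induction on \<open>n\<close>: primality is applied to the sum of \<open>x\<close> and
  \<open>of_nat n * x\<close>.\<close>

lemma prime_in_dvd_of_nat_mult:
  assumes "puiseux_monoid M" and "prime_in M p" and "x \<in> M"
    and "divides_in M p (of_nat n * x)" and "0 < n"
  shows "divides_in M p x"
  using assms(4,5)
proof (induction n)
  case (Suc n)
  show ?case
  \<comment> \<open>The induction hypothesis covers only positive multipliers, so the multiple
    \<open>1 * x\<close> is treated separately.\<close>
  proof (cases "n = 0")
    case False
    have "divides_in M p x \<or> divides_in M p (of_nat n * x)"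
      using Suc.prems(1) assms(2,3) puiseux_monoid_of_nat_mult[OF assms(1,3), of n]
      by (simp add: distrib_right prime_in_def)
    with False Suc.IH show ?thesis by blast
  qed (use Suc.prems in simp)
qed simp

text \<open>The prime divides a common multiple of \<open>p\<close> and \<open>b\<close>, hence
  \<open>b\<close> itself; an atom \<open>b = p + x\<close> with \<open>p\<close> nonzero leaves
  only \<open>x = 0\<close>.\<close>

lemma prime_in_eq_atom:
  assumes "puiseux_monoid M" and "prime_in M p" and "b \<in> atoms M"
  shows "b = p"
proof -
  have p: "p \<in> M" "p \<noteq> 0" using assms(2) by (auto simp: prime_in_def)
  have b: "b \<in> M" using assms(3) by (auto simp: atoms_def)
  have "0 < p" "0 < b"
    using p puiseux_monoidD(3)[OF assms(1), of p] atoms_pos assms(1,3) by auto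
  then obtain m n :: nat where mn: "0 < m" "0 < n" "of_nat m * p = of_nat n * b"
    by (rule common_multiple_pos_rat)
  \<comment> \<open>Since \<open>m\<close> is positive, one copy of \<open>p\<close> can be split
    off.\<close>
  have "of_nat n * b = p + of_nat (m - 1) * p"
    using mn by (simp add: of_nat_diff left_diff_distrib flip: mn(3))
  then have "divides_in M p (of_nat n * b)"
    using puiseux_monoid_of_nat_mult[OF assms(1) p(1)] by (auto simp: divides_in_def)
  then have "divides_in M p b"
    using prime_in_dvd_of_nat_mult[OF assms(1,2) b] mn(2) by blast
  then obtain x where "x \<in> M" "b = p + x"
    by (auto simp: divides_in_def)
  with assms(3) p show ?thesis
    by (auto simp: atoms_def)
qed

text \<open>The preimage \<open>a\<close> of 1 can be split off every nonzero element, so no other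
  element can be an atom.\<close>

lemma iso_nat_atoms_eq:
  assumes "puiseux_monoid M" and "additive_monoid M \<cong> additive_monoid (UNIV :: nat set)"
  shows "\<exists>a. atoms M \<subseteq> {a}"
proof -
  obtain h :: "rat \<Rightarrow> nat" where add: "\<And>x y. x \<in> M \<Longrightarrow> y \<in> M \<Longrightarrow> h (x + y) = h x + h y"
    and bij: "bij_betw h M UNIV"
    using assms(2) by (auto simp: is_iso_def iso_def hom_def additive_monoid_def)
  have inj: "x = y" if "x \<in> M" "y \<in> M" "h x = h y" for x y
    using bij that by (auto simp: bij_betw_def dest: inj_onD)
  have surj: "\<exists>x\<in>M. h x = n" for n
    using bij by (metis UNIV_I bij_betw_def imageE)
  note M = puiseux_monoidD[OF assms(1)]
  \<comment> \<open>\<open>hom\<close> demands only additivity; the unit is preserved because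
    \<open>h 0 = h 0 + h 0\<close> cancels in the naturals.\<close>
  have h0: "h 0 = 0"
    using add[OF M(1) M(1)] by simp
  obtain a where a: "a \<in> M" "h a = 1" using surj by blast
  have "b = a" if b: "b \<in> atoms M" for b
  proof -
    have bM: "b \<in> M" "b \<noteq> 0" using b by (auto simp: atoms_def)
    then have "h b \<noteq> 0" using inj[of b 0] M(1) h0 by auto
    \<comment> \<open>The subtraction is not truncated, as \<open>h b\<close> is nonzero; thus
      \<open>b\<close> and \<open>a + c\<close> have the same image.\<close>
    obtain c where c: "c \<in> M" "h c = h b - 1" using surj by blast
    have "b = a + c"
      using inj[OF bM(1) M(2)[OF a(1) c(1)]] add[OF a(1) c(1)] a c \<open>h b \<noteq> 0\<close> by simp
    moreover have "a \<noteq> 0" using a h0 by auto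
    ultimately show ?thesis using b a c by (auto simp: atoms_def)
  qed
  then show ?thesis by blast
qed

lemma single_atom_factorization:
  assumes "atoms M = {a}" and "F \<in> factorizations M x"
  shows "F = replicate_mset (size F) a" and "x = of_nat (size F) * a"
proof -
  have "\<forall>b\<in>#F. b = a"
    using assms by (auto simp: factorizations_def)
  then show F: "F = replicate_mset (size F) a"
    by (metis set_mset_subset_singletonD singleton_iff subsetI)
  have "x = sum_mset (replicate_mset (size F) a)"
    using assms(2) F by (simp add: factorizations_def)
  then show "x = of_nat (size F) * a" by simp
qed

text \<open>With one atom \<open>a\<close>, a factorization is determined by its size, and the size
  by the sum, because \<open>a\<close> is nonzero.\<close>

lemma single_atom_imp_UFM:
  assumes "atomic M" and "atoms M = {a}"
  shows "UFM M"
  unfolding UFM_def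
proof (intro conjI ballI)
  fix x assume "x \<in> M"
  then obtain F where F: "F \<in> factorizations M x"
    using factorizations_nonempty[OF assms(1)] by blast
  have "a \<noteq> 0" using assms(2) by (auto simp: atoms_def)
  have "G = F" if "G \<in> factorizations M x" for G
  proof -
    have "size G = size F"
      using single_atom_factorization(2)[OF assms(2) F] single_atom_factorization(2)[OF assms(2) that]
        \<open>a \<noteq> 0\<close> by simp
    then show ?thesis
      using single_atom_factorization(1)[OF assms(2) F] single_atom_factorization(1)[OF assms(2) that]
      by metis
  qed
  with F have "factorizations M x = {F}" by blast
  then show "card (factorizations M x) = 1" by simp
qed fact

lemma single_atom_eq_multiples:
  assumes "puiseux_monoid M" and "atomic M" and "atoms M = {a}"
  shows "M = range (\<lambda>n. of_nat n * a)"
proof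
  show "M \<subseteq> range (\<lambda>n. of_nat n * a)"
    using factorizations_nonempty[OF assms(2)] single_atom_factorization(2)[OF assms(3)] by blast
  have "a \<in> M" using assms(3) by (auto simp: atoms_def)
  then show "range (\<lambda>n. of_nat n * a) \<subseteq> M"
    using puiseux_monoid_of_nat_mult[OF assms(1)] by blast
qed

lemma multiples_iso_nat:
  fixes a :: rat
  assumes "a \<noteq> 0"
  shows "additive_monoid (range (\<lambda>n. of_nat n * a)) \<cong> additive_monoid (UNIV :: nat set)"
proof -
  let ?f = "\<lambda>n::nat. of_nat n * a"
  \<comment> \<open>The isomorphism has to go from the multiples to the naturals, so the inverse of
    the evident map is used.\<close>
  let ?g = "inv_into UNIV ?f"
  have inj: "inj ?f" using assms by (auto intro: injI)
  then have "bij_betw (?g) (range ?f) UNIV"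
    by (simp add: bij_betw_def inj_on_inv_into)
  moreover have "?g (?f m + ?f n) = ?g (?f m) + ?g (?f n)" for m n
    using inv_f_f[OF inj, of "m + n"] by (simp add: distrib_right inv_f_f[OF inj])
  ultimately have "?g \<in> iso (additive_monoid (range ?f)) (additive_monoid UNIV)"
    by (auto simp: iso_def hom_def additive_monoid_def)
  then show ?thesis by (auto simp: is_iso_def)
qed

text \<open>The generator divides every multiple \<open>of_nat n * a\<close> with \<open>n\<close>
  nonzero, so primality can only fail when both summands are 0.\<close>

lemma generator_prime_in:
  fixes a :: rat
  assumes "0 < a"
  shows "prime_in (range (\<lambda>n. of_nat n * a)) a"
proof -
  let ?f = "\<lambda>n::nat. of_nat n * a"
  have dvd: "divides_in (range ?f) a (?f n)" if "n \<noteq> 0" for n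
  proof -
    have "?f n = a + ?f (n - 1)" using that by (simp add: of_nat_diff left_diff_distrib)
    then show ?thesis by (auto simp: divides_in_def)
  qed
  \<comment> \<open>Anything divisible by \<open>a\<close> is positive, which rules out the
    remaining case of two zero summands.\<close>
  have "0 < a + ?f n" for n
    using assms by (simp add: add_pos_nonneg)
  then have "\<not> divides_in (range ?f) a (0 + 0)"
    by (auto simp: divides_in_def) (metis less_irrefl)
  then have "divides_in (range ?f) a (?f m) \<or> divides_in (range ?f) a (?f n)"
    if "divides_in (range ?f) a (?f m + ?f n)" for m n
    using that dvd by (cases "m = 0"; cases "n = 0") auto
  moreover have "a \<in> range ?f" by (rule range_eqI[of _ _ 1]) simp
  ultimately show ?thesis
    using assms by (auto simp: prime_in_def)
qed

theorem proposition4p22: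
  fixes M :: "rat set"
  assumes "puiseux_monoid M" and "M \<noteq> {0}" and "atomic M"
  shows "(UFM M \<longleftrightarrow> HFM M)
       \<and> (HFM M \<longleftrightarrow> additive_monoid M \<cong> additive_monoid (UNIV :: nat set))
       \<and> (additive_monoid M \<cong> additive_monoid (UNIV :: nat set) \<longleftrightarrow> (\<exists>p. prime_in M p))"
proof -
  let ?iso = "additive_monoid M \<cong> additive_monoid (UNIV :: nat set)"
  let ?single = "\<exists>a. atoms M = {a}"
  have nonempty: "atoms M \<noteq> {}"
    using assms by (rule atoms_nonempty)
  have "?single" if "HFM M"
    using HFM_atoms_eq[OF assms(1) that] nonempty by blast
  moreover have "?single" if "prime_in M p" for p
    using prime_in_eq_atom[OF assms(1) that] nonempty by blast
  moreover have "?single" if ?iso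
    using iso_nat_atoms_eq[OF assms(1) that] nonempty by blast
  moreover have "UFM M \<and> ?iso \<and> (\<exists>p. prime_in M p)" if single: ?single
  proof -
    obtain a where a: "atoms M = {a}" using single by blast
    then have "0 < a" using atoms_pos[OF assms(1)] by blast
    \<comment> \<open>Identifying \<open>M\<close> with the multiples of \<open>a\<close> carries
      the isomorphism and the prime element over to \<open>M\<close>.\<close>
    moreover note single_atom_eq_multiples[OF assms(1,3) a]
    ultimately show ?thesis
      using single_atom_imp_UFM[OF assms(3) a] multiples_iso_nat[of a] generator_prime_in[of a]
      by auto
  qed
  ultimately show ?thesis using UFM_imp_HFM by blast
qed

end
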